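(* For $|q|<1$, $$\sum_{n=1}^{\infty} R_3(n)\, q^n = \frac{q^6(1+2q+q^2+2q^3-q^4-q^6-q^7+q^8)}{(1-q)^3(1+q+q^2)},$$ where $R_3(n)$ is the number of partitions of $n$ with max-rook number $3$.
   Context: A partition $\pi$ of a positive integer $n$ is a non-increasing sequence of positive integers $(\lambda_1,\dots,\lambda_r)$ with sum $n$; $\mathscr{P}(n)$ is the set of all partitions of $n$. The Ferrers board $B_\pi$ of $\pi=(\lambda_1,\dots,\lambda_r)$ is the left-justified array of unit squares with $r$ rows whose $i$-th row from the top has $\lambda_i$ squares. Rooks placed on squares of the board are non-intersecting if no two of them lie in the same row or the same column. The max-rook number $R(\pi)$ is the maximal number of non-intersecting rooks that can be placed in $B_\pi$. For positive integers $n,k$, $R_k(n):=\#\{\pi\in\mathscr{P}(n) : R(\pi)=k\}$. *)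

theory Defs
  imports Complex_Main
begin

definition partitions_of :: "nat \<Rightarrow> nat list set" where
  "partitions_of n = {p. sorted_wrt (\<ge>) p \<and> (\<forall>x\<in>set p. 0 < x) \<and> sum_list p = n}"

(* Squares are pairs (row, column), both counted from 0. *)
definition ferrers_board :: "nat list \<Rightarrow> (nat \<times> nat) set" where
  "ferrers_board p = {(i, j). i < length p \<and> j < p ! i}"

definition non_intersecting :: "(nat \<times> nat) set \<Rightarrow> bool" where
  "non_intersecting S \<longleftrightarrow>
     (\<forall>s\<in>S. \<forall>t\<in>S. s \<noteq> t \<longrightarrow> fst s \<noteq> fst t \<and> snd s \<noteq> snd t)"

definition max_rook_number :: "nat list \<Rightarrow> nat" where
  "max_rook_number p = Max {card S | S. S \<subseteq> ferrers_board p \<and> non_intersecting S}"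

definition rook_partition_count :: "nat \<Rightarrow> nat \<Rightarrow> nat" where
  "rook_partition_count k n = card {p \<in> partitions_of n. max_rook_number p = k}"

text \<open>\<^const>\<open>Max\<close> and \<^const>\<open>card\<close> are meaningful only on finite sets (nonempty ones for
  \<^const>\<open>Max\<close>); the following facts show that they are used as intended above.\<close>

lemma finite_ferrers_board: "finite (ferrers_board p)"
proof -
  have "ferrers_board p = Sigma {..<length p} (\<lambda>i. {..<p ! i})"
    by (auto simp: ferrers_board_def)
  then show ?thesis by simp
qed

lemma finite_rook_placements:
  "finite {card S | S. S \<subseteq> ferrers_board p \<and> non_intersecting S}"
proof -
  have "{card S | S. S \<subseteq> ferrers_board p \<and> non_intersecting S} \<subseteq> card ` Pow (ferrers_board p)"
    by auto
  then show ?thesis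
    by (rule finite_subset) (simp add: finite_ferrers_board)
qed

lemma rook_placements_nonempty:
  "{card S | S. S \<subseteq> ferrers_board p \<and> non_intersecting S} \<noteq> {}"
proof -
  have "{} \<subseteq> ferrers_board p \<and> non_intersecting {}"
    by (simp add: non_intersecting_def)
  then show ?thesis by blast
qed

lemma length_le_sum_list: "\<forall>x\<in>set p. 0 < x \<Longrightarrow> length p \<le> sum_list (p :: nat list)"
  by (induction p) auto

lemma finite_partitions_of: "finite (partitions_of n)"
proof -
  have "partitions_of n \<subseteq> {p. set p \<subseteq> {..n} \<and> length p \<le> n}"
    by (auto simp: partitions_of_def length_le_sum_list member_le_sum_list)
  then show ?thesis
    by (rule finite_subset) (rule finite_lists_length_le, simp)
qed

end

theory Submission
  imports Defs "HOL-Analysis.Analysis"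
begin

text \<open>
A partition has max-rook number at least \<open>k\<close> exactly when its board contains the staircase with
row lengths \<open>k, k - 1, \<dots>, 1\<close> (lemma \<open>le_max_rook_number_iff\<close>): rooks on the antidiagonal of the
staircase do not attack each other, and if some row of the board is too short for the staircase,
then the rows above it together with the columns meeting it are fewer than \<open>k\<close> lines that cover the
whole board, and each line carries at most one rook.

Hence the partitions with max-rook number three are the \<open>(a, b, c, r)\<close> (three largest parts
\<open>a \<ge> b \<ge> c \<ge> 1\<close>, list \<open>r\<close> of remaining parts) with \<open>a \<ge> 3\<close> and \<open>b \<ge> 2\<close> such that \<open>r\<close> is empty or
\<open>c = 1\<close> or \<open>b = 2\<close> or \<open>a = 3\<close>. They split into seven disjoint families:
\<^item> \<open>b \<ge> 3, c = 1\<close>, and its conjugate family \<open>b = c = 2, a \<ge> 3\<close>;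
\<^item> \<open>b = 2, c = 1, a \<ge> 3\<close>;
\<^item> exactly three parts, with \<open>b \<ge> 3, c = 2\<close> or with \<open>c \<ge> 3\<close>;
\<^item> at least four parts, with \<open>a = b = 3\<close> and \<open>c = 2\<close> or \<open>c = 3\<close>.

Each family is parametrised by two or three free natural numbers on which the size depends
affinely, except that in the last two the origin is left out, since it gives a partition with three
parts. The weights \<open>q ^ n\<close> of a family therefore sum to a product of geometric series, minus one
term in the last two cases. All sums converge absolutely, so the seven sums add up to an unordered
sum over all partitions with max-rook number three, and grouping by size turns it into the power
series (lemmas \<open>has_sum_max_rook_number_3\<close> and \<open>has_sum_imp_sums_rook_partition_count\<close>).
\<close>

section \<open>Rook placements and staircases\<close>

text \<open>Partitions of an arbitrary size, as weakly decreasing lists of positive parts.\<close>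
definition integer_partition :: "nat list \<Rightarrow> bool" where
  "integer_partition p \<longleftrightarrow> sorted_wrt (\<ge>) p \<and> (\<forall>x\<in>set p. 0 < x)"

lemma max_rook_number_attained:
  obtains S where "S \<subseteq> ferrers_board p" "non_intersecting S" "card S = max_rook_number p"
proof -
  have "max_rook_number p \<in> {card S | S. S \<subseteq> ferrers_board p \<and> non_intersecting S}"
    unfolding max_rook_number_def
    by (rule Max_in[OF finite_rook_placements rook_placements_nonempty])
  then show ?thesis using that by auto
qed

lemma card_le_max_rook_number:
  assumes "S \<subseteq> ferrers_board p" "non_intersecting S"
  shows "card S \<le> max_rook_number p"
  unfolding max_rook_number_def
  by (rule Max_ge[OF finite_rook_placements]) (use assms in auto)

text \<open>The easy half of Koenig's theorem: rooks cannot outnumber the lines of a cover, here by the first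
  \<open>i\<close> rows and the first \<open>c\<close> columns.\<close>
lemma card_rooks_le_cover:
  assumes "non_intersecting S"
    and cover: "\<And>a b. (a, b) \<in> S \<Longrightarrow> a < i \<or> b < c"
  shows "card S \<le> i + c"
proof -
  define S1 where "S1 = {s \<in> S. fst s < i}"
  define S2 where "S2 = {s \<in> S. snd s < c}"
  have "inj_on fst S" "inj_on snd S"
    using assms(1) unfolding non_intersecting_def inj_on_def by blast+
  then have inj: "inj_on fst S1" "inj_on snd S2"
    unfolding S1_def S2_def by (auto elim: inj_on_subset)
  have sub: "fst ` S1 \<subseteq> {..<i}" "snd ` S2 \<subseteq> {..<c}"
    by (auto simp: S1_def S2_def)
  have "card S1 \<le> i"
    using card_inj_on_le[OF inj(1) sub(1)] by simp
  moreover have "card S2 \<le> c"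
    using card_inj_on_le[OF inj(2) sub(2)] by simp
  moreover have "S = S1 \<union> S2"
    using cover by (force simp: S1_def S2_def)
  then have "card S \<le> card S1 + card S2"
    by (metis card_Un_le)
  ultimately show ?thesis by linarith
qed

lemma le_max_rook_number_iff:
  assumes p: "integer_partition p"
  shows "k \<le> max_rook_number p \<longleftrightarrow> (\<forall>i<k. i < length p \<and> k - i \<le> p ! i)"
proof
  assume stair: "\<forall>i<k. i < length p \<and> k - i \<le> p ! i"
  define S where "S = (\<lambda>i. (i, k - 1 - i)) ` {..<k}"
  have "S \<subseteq> ferrers_board p"
  proof -
    have "k - 1 - i < p ! i" if "i < k" for i
      using stair[rule_format, OF that] that by linarith
    then show ?thesis
      using stair by (auto simp: S_def ferrers_board_def)
  qed
  moreover have "non_intersecting S"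
    by (auto simp: non_intersecting_def S_def)
  moreover have "card S = k"
    unfolding S_def by (subst card_image) (auto simp: inj_on_def)
  ultimately show "k \<le> max_rook_number p"
    using card_le_max_rook_number by metis
next
  assume k: "k \<le> max_rook_number p"
  obtain S where S: "S \<subseteq> ferrers_board p" "non_intersecting S" "card S = max_rook_number p"
    by (rule max_rook_number_attained)
  show "\<forall>i<k. i < length p \<and> k - i \<le> p ! i"
  proof (rule ccontr)
    assume "\<not> ?thesis"
    then obtain i where i: "i < k" "\<not> (i < length p \<and> k - i \<le> p ! i)" by blast
    \<comment> \<open>The number of columns meeting row \<open>i\<close>, which is zero if the board has no such row.\<close>
    define c where "c = (if i < length p then p ! i else 0)"
    have c: "i + c < k"
      using i by (auto simp: c_def)
    have "card S \<le> i + c"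
    proof (rule card_rooks_le_cover[OF S(2)])
      fix a b assume "(a, b) \<in> S"
      then have ab: "a < length p" "b < p ! a"
        using S(1) by (auto simp: ferrers_board_def)
      show "a < i \<or> b < c"
      proof (cases "a < i")
        case False
        then have "p ! a \<le> p ! i"
          using p ab by (cases "a = i") (auto simp: integer_partition_def sorted_wrt_iff_nth_less)
        then show ?thesis
          using False ab by (auto simp: c_def)
      qed simp
    qed
    with S(3) k c show False by linarith
  qed
qed

section \<open>The families of partitions with max-rook number three\<close>

text \<open>Partitions with at least three parts, subject to a condition on the three largest parts and the list
  of the remaining ones.\<close>
definition partitions_with :: "(nat \<Rightarrow> nat \<Rightarrow> nat \<Rightarrow> nat list \<Rightarrow> bool) \<Rightarrow> nat list set" where
  "partitions_with P = {a # b # c # r | a b c r. integer_partition (a # b # c # r) \<and> P a b c r}"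

lemma partitions_with_cong:
  assumes "\<And>a b c r. integer_partition (a # b # c # r) \<Longrightarrow> P a b c r \<longleftrightarrow> Q a b c r"
  shows "partitions_with P = partitions_with Q"
  unfolding partitions_with_def by (simp add: assms cong: conj_cong)

lemma partitions_with_max_rook_number_3:
  "{p. integer_partition p \<and> max_rook_number p = 3} =
   partitions_with (\<lambda>a b c r. 3 \<le> a \<and> 2 \<le> b \<and> (r = [] \<or> c = 1 \<or> b = 2 \<or> a = 3))"
proof -
  have iff: "max_rook_number p = 3 \<longleftrightarrow>
     (\<exists>a b c r. p = a # b # c # r \<and> 3 \<le> a \<and> 2 \<le> b \<and> (r = [] \<or> c = 1 \<or> b = 2 \<or> a = 3))"
    if p: "integer_partition p" for p
  proof -
    have "max_rook_number p = 3 \<longleftrightarrow> 3 \<le> max_rook_number p \<and> \<not> 4 \<le> max_rook_number p"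
      by linarith
    also have "\<dots> \<longleftrightarrow> (\<forall>i<3. i < length p \<and> 3 - i \<le> p ! i) \<and>
        \<not> (\<forall>i<4. i < length p \<and> 4 - i \<le> p ! i)"
      unfolding le_max_rook_number_iff[OF p] ..
    also have "\<dots> \<longleftrightarrow>
        (\<exists>a b c r. p = a # b # c # r \<and> 3 \<le> a \<and> 2 \<le> b \<and> (r = [] \<or> c = 1 \<or> b = 2 \<or> a = 3))"
    proof (cases "length p < 3")
      case True
      then show ?thesis by auto
    next
      case False
      then obtain a b c r where abc: "p = a # b # c # r"
        by (metis One_nat_def Suc_1 length_Cons less_Suc_eq_0_disj list.size(3) neq_Nil_conv
            numeral_3_eq_3)
      have "0 < c" "r = [] \<or> 0 < hd r"
        using p abc by (cases r; auto simp: integer_partition_def)+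
      then show ?thesis
        unfolding abc by (cases r) (auto simp: numeral_eq_Suc All_less_Suc2)
    qed
    finally show ?thesis .
  qed
  show ?thesis
    unfolding partitions_with_def using iff by blast
qed

lemma partition_parts_le_1:
  assumes "integer_partition p" "\<forall>x\<in>set p. x \<le> 1"
  shows "\<exists>k. p = replicate k 1"
proof -
  have "p = replicate (length p) 1"
    using assms by (intro replicate_eqI) (auto simp: integer_partition_def le_Suc_eq)
  then show ?thesis ..
qed

lemma partition_parts_le_2:
  assumes "integer_partition p" "\<forall>x\<in>set p. x \<le> 2"
  shows "\<exists>j k. p = replicate j 2 @ replicate k 1"
  using assms
proof (induction p)
  case (Cons a p)
  have p: "integer_partition p" "\<forall>x\<in>set p. x \<le> a" "a = 1 \<or> a = 2"
    using Cons.prems by (auto simp: integer_partition_def le_Suc_eq numeral_2_eq_2)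
  show ?case
  proof (cases "a = 1")
    case True
    then obtain k where "a # p = replicate k 1"
      using partition_parts_le_1[OF Cons.prems(1)] p by auto
    then show ?thesis by (intro exI[of _ 0] exI[of _ k]) simp
  next
    case False
    with p Cons.IH Cons.prems obtain j k where "p = replicate j 2 @ replicate k 1"
      by auto
    with False p show ?thesis by (intro exI[of _ "Suc j"] exI[of _ k]) simp
  qed
qed simp

lemma partition_parts_le_3:
  assumes "integer_partition p" "\<forall>x\<in>set p. x \<le> 3"
  shows "\<exists>i j k. p = replicate i 3 @ replicate j 2 @ replicate k 1"
  using assms
proof (induction p)
  case (Cons a p)
  have p: "integer_partition p" "\<forall>x\<in>set p. x \<le> a" "a \<le> 3"
    using Cons.prems by (auto simp: integer_partition_def)
  show ?case
  proof (cases "a \<le> 2")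
    case True
    then obtain j k where "a # p = replicate j 2 @ replicate k 1"
      using partition_parts_le_2[OF Cons.prems(1)] p by fastforce
    then show ?thesis by (intro exI[of _ 0] exI[of _ j] exI[of _ k]) simp
  next
    case False
    with p Cons.IH Cons.prems obtain i j k where "p = replicate i 3 @ replicate j 2 @ replicate k 1"
      by auto
    with False p show ?thesis
      by (intro exI[of _ "Suc i"] exI[of _ j] exI[of _ k]) simp
  qed
qed simp

lemma integer_partition_Cons:
  "integer_partition (a # p) \<longleftrightarrow> 0 < a \<and> (\<forall>x\<in>set p. x \<le> a) \<and> integer_partition p"
  by (auto simp: integer_partition_def)

lemma integer_partition_Nil: "integer_partition []"
  by (simp add: integer_partition_def)

lemma integer_partition_append:
  "integer_partition (p @ p') \<longleftrightarrow>
     integer_partition p \<and> integer_partition p' \<and> (\<forall>x\<in>set p. \<forall>y\<in>set p'. y \<le> x)"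
  by (auto simp: integer_partition_def sorted_wrt_append)

lemma integer_partition_replicate: "0 < a \<Longrightarrow> integer_partition (replicate n a)"
  by (induction n) (auto simp: integer_partition_def)

lemmas integer_partition_simps =
  integer_partition_Cons integer_partition_Nil integer_partition_append integer_partition_replicate

lemma count_list_replicate: "count_list (replicate n a) b = (if a = b then n else 0)"
  by (induction n) auto

lemma bij_betw_partitions_withI:
  assumes left: "\<And>t. t \<in> T \<Longrightarrow> g (f t) = t"
    and into: "\<And>t. t \<in> T \<Longrightarrow> f t \<in> partitions_with P"
    and onto: "\<And>a b c r. \<lbrakk>integer_partition (a # b # c # r); P a b c r\<rbrakk> \<Longrightarrow> \<exists>t\<in>T. a # b # c # r = f t"
  shows "bij_betw f T (partitions_with P)"
  unfolding bij_betw_def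
proof
  show "inj_on f T" using left by (rule inj_on_inverseI)
  show "f ` T = partitions_with P"
    using into onto unfolding partitions_with_def by fast
qed

text \<open>Coordinates on the seven families. In each one, the first three list entries are displayed
  explicitly and the remaining parts are counted by multiplicity.\<close>

lemma bij_betw_third_one:
  "bij_betw (\<lambda>(x, y, z). (3 + y + x) # (3 + y) # 1 # replicate z 1) UNIV
     (partitions_with (\<lambda>a b c r. 3 \<le> b \<and> c = 1))"
proof (rule bij_betw_partitions_withI[where g = "\<lambda>p. (p ! 0 - p ! 1, p ! 1 - 3, length p - 3)"])
  fix a b c r assume *: "integer_partition (a # b # c # r)" "3 \<le> b \<and> c = (1::nat)"
  then have "\<exists>k. r = replicate k 1"
    by (intro partition_parts_le_1) (auto simp: integer_partition_simps)
  then obtain k where "r = replicate k 1" ..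
  then show "\<exists>t\<in>UNIV. a # b # c # r = (case t of (x, y, z) \<Rightarrow> (3 + y + x) # (3 + y) # 1 # replicate z 1)"
    using * by (intro bexI[of _ "(a - b, b - 3, k)"]) (auto simp: integer_partition_simps)
qed (auto simp: integer_partition_simps partitions_with_def)

lemma bij_betw_two_two:
  "bij_betw (\<lambda>(x, y, z). (3 + x) # 2 # 2 # replicate y 2 @ replicate z 1) UNIV
     (partitions_with (\<lambda>a b c r. 3 \<le> a \<and> b = 2 \<and> c = 2))"
proof (rule bij_betw_partitions_withI[where
      g = "\<lambda>p. (p ! 0 - 3, count_list (drop 3 p) 2, count_list (drop 3 p) 1)"])
  fix a b c r assume *: "integer_partition (a # b # c # r)" "3 \<le> a \<and> b = 2 \<and> c = (2::nat)"
  then have "\<exists>j k. r = replicate j 2 @ replicate k 1"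
    by (intro partition_parts_le_2) (auto simp: integer_partition_simps)
  then obtain j k where "r = replicate j 2 @ replicate k 1" by blast
  then show "\<exists>t\<in>UNIV. a # b # c # r =
      (case t of (x, y, z) \<Rightarrow> (3 + x) # 2 # 2 # replicate y 2 @ replicate z 1)"
    using * by (intro bexI[of _ "(a - 3, j, k)"]) (auto simp: integer_partition_simps)
qed (auto simp: integer_partition_simps partitions_with_def count_list_replicate)

lemma bij_betw_two_one:
  "bij_betw (\<lambda>(x, z). (3 + x) # 2 # 1 # replicate z 1) UNIV
     (partitions_with (\<lambda>a b c r. 3 \<le> a \<and> b = 2 \<and> c = 1))"
proof (rule bij_betw_partitions_withI[where g = "\<lambda>p. (p ! 0 - 3, length p - 3)"])
  fix a b c r assume *: "integer_partition (a # b # c # r)" "3 \<le> a \<and> b = 2 \<and> c = (1::nat)"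
  then have "\<exists>k. r = replicate k 1"
    by (intro partition_parts_le_1) (auto simp: integer_partition_simps)
  then obtain k where "r = replicate k 1" ..
  then show "\<exists>t\<in>UNIV. a # b # c # r = (case t of (x, z) \<Rightarrow> (3 + x) # 2 # 1 # replicate z 1)"
    using * by (intro bexI[of _ "(a - 3, k)"]) (auto simp: integer_partition_simps)
qed (auto simp: integer_partition_simps partitions_with_def)

lemma bij_betw_three_parts_last_two:
  "bij_betw (\<lambda>(x, y). [3 + y + x, 3 + y, 2]) UNIV
     (partitions_with (\<lambda>a b c r. r = [] \<and> 3 \<le> b \<and> c = 2))"
proof (rule bij_betw_partitions_withI[where g = "\<lambda>p. (p ! 0 - p ! 1, p ! 1 - 3)"])
  fix a b c :: nat and r
  assume *: "integer_partition (a # b # c # r)" "r = [] \<and> 3 \<le> b \<and> c = (2::nat)"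
  then show "\<exists>t\<in>UNIV. a # b # c # r = (case t of (x, y) \<Rightarrow> [3 + y + x, 3 + y, 2])"
    by (intro bexI[of _ "(a - b, b - 3)"]) (auto simp: integer_partition_simps)
qed (auto simp: integer_partition_simps partitions_with_def)

lemma bij_betw_three_parts:
  "bij_betw (\<lambda>(x, y, z). [3 + z + y + x, 3 + z + y, 3 + z]) UNIV
     (partitions_with (\<lambda>a b c r. r = [] \<and> 3 \<le> c))"
proof (rule bij_betw_partitions_withI[where g = "\<lambda>p. (p ! 0 - p ! 1, p ! 1 - p ! 2, p ! 2 - 3)"])
  fix a b c :: nat and r
  assume *: "integer_partition (a # b # c # r)" "r = [] \<and> 3 \<le> c"
  then show "\<exists>t\<in>UNIV. a # b # c # r =
      (case t of (x, y, z) \<Rightarrow> [3 + z + y + x, 3 + z + y, 3 + z])"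
    by (intro bexI[of _ "(a - b, b - c, c - 3)"]) (auto simp: integer_partition_simps)
qed (auto simp: integer_partition_simps partitions_with_def)

text \<open>The excluded origin is the partition with parts \<open>3, 3, 2\<close>, which has only three parts; likewise
  \<open>3, 3, 3\<close> in the family after this one.\<close>
lemma bij_betw_parts_le_3_third_two:
  "bij_betw (\<lambda>(x, y). 3 # 3 # 2 # replicate y 2 @ replicate x 1) (UNIV - {(0, 0)})
     (partitions_with (\<lambda>a b c r. r \<noteq> [] \<and> a = 3 \<and> b = 3 \<and> c = 2))"
proof (rule bij_betw_partitions_withI[where
      g = "\<lambda>p. (count_list (drop 3 p) 1, count_list (drop 3 p) 2)"])
  fix a b c r assume *: "integer_partition (a # b # c # r)" "r \<noteq> [] \<and> a = 3 \<and> b = 3 \<and> c = (2::nat)"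
  then have "\<exists>j k. r = replicate j 2 @ replicate k 1"
    by (intro partition_parts_le_2) (auto simp: integer_partition_simps)
  then obtain j k where "r = replicate j 2 @ replicate k 1" by blast
  then show "\<exists>t\<in>UNIV - {(0, 0)}. a # b # c # r =
      (case t of (x, y) \<Rightarrow> 3 # 3 # 2 # replicate y 2 @ replicate x 1)"
    using * by (intro bexI[of _ "(k, j)"]) auto
qed (auto simp: integer_partition_simps partitions_with_def count_list_replicate)

lemma bij_betw_parts_le_3:
  "bij_betw (\<lambda>(x, y, z). 3 # 3 # 3 # replicate z 3 @ replicate y 2 @ replicate x 1)
     (UNIV - {(0, 0, 0)})
     (partitions_with (\<lambda>a b c r. r \<noteq> [] \<and> a = 3 \<and> b = 3 \<and> c = 3))"
proof (rule bij_betw_partitions_withI[where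
      g = "\<lambda>p. (count_list (drop 3 p) 1, count_list (drop 3 p) 2, count_list (drop 3 p) 3)"])
  fix a b c r assume *: "integer_partition (a # b # c # r)" "r \<noteq> [] \<and> a = 3 \<and> b = 3 \<and> c = (3::nat)"
  then have "\<exists>i j k. r = replicate i 3 @ replicate j 2 @ replicate k 1"
    by (intro partition_parts_le_3) (auto simp: integer_partition_simps)
  then obtain i j k where "r = replicate i 3 @ replicate j 2 @ replicate k 1" by blast
  then show "\<exists>t\<in>UNIV - {(0, 0, 0)}. a # b # c # r =
      (case t of (x, y, z) \<Rightarrow> 3 # 3 # 3 # replicate z 3 @ replicate y 2 @ replicate x 1)"
    using * by (intro bexI[of _ "(k, j, i)"]) auto
qed (auto simp: integer_partition_simps partitions_with_def count_list_replicate)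

section \<open>Generating functions\<close>

lemma has_sum_mult_Times:
  fixes f :: "'a \<Rightarrow> complex" and g :: "'b \<Rightarrow> complex"
  assumes f: "(f has_sum a) A" and g: "(g has_sum b) B"
  shows "((\<lambda>(x, y). f x * g y) has_sum (a * b)) (A \<times> B)"
proof (rule has_sum_SigmaI[where g = "\<lambda>x. f x * b"])
  show "((\<lambda>y. case (x, y) of (x, y) \<Rightarrow> f x * g y) has_sum (f x * b)) B" for x
    using has_sum_cmult_right[OF g] by simp
  show "((\<lambda>x. f x * b) has_sum a * b) A"
    by (rule has_sum_cmult_left[OF f])
  have fs: "(\<lambda>x. norm (f x)) summable_on A" and gs: "(\<lambda>x. norm (g x)) summable_on B"
    using f g summable_on_iff_abs_summable_on_complex summable_on_def by blast+
  have "(\<lambda>t. norm (case t of (x, y) \<Rightarrow> f x * g y)) summable_on A \<times> B"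
    unfolding Infinite_Sum.abs_summable_on_Sigma_iff
    using fs gs
    by (auto simp: norm_mult infsum_cmult_right' abs_mult infsum_nonneg
        intro!: summable_on_cmult_right summable_on_cmult_left)
  then show "(\<lambda>(x, y). f x * g y) summable_on A \<times> B"
    by (rule abs_summable_summable)
qed

lemma has_sum_geometric_power:
  fixes q :: complex
  assumes "norm q < 1" "0 < d"
  shows "((\<lambda>n. q ^ (d * n)) has_sum (1 / (1 - q ^ d))) UNIV"
proof -
  have n: "norm (q ^ d) < 1"
    using assms by (simp add: norm_power power_less_one_iff)
  have "((\<lambda>n. (q ^ d) ^ n) has_sum (1 / (1 - q ^ d))) UNIV"
    using n by (intro norm_summable_imp_has_sum geometric_sums)
      (simp_all add: norm_power[of "q ^ d"] summable_geometric)
  then show ?thesis by (simp add: power_mult)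
qed

lemma has_sum_two_parameters:
  fixes q :: complex
  assumes "norm q < 1" "0 < d" "0 < e"
  shows "((\<lambda>(x, y). q ^ (n + d * x + e * y)) has_sum (q ^ n / ((1 - q ^ d) * (1 - q ^ e)))) UNIV"
  using has_sum_cmult_right[OF has_sum_mult_Times[OF has_sum_geometric_power[OF assms(1,2)]
      has_sum_geometric_power[OF assms(1,3)]], of "q ^ n"]
  by (simp add: power_add mult_ac case_prod_unfold)

lemma has_sum_three_parameters:
  fixes q :: complex
  assumes "norm q < 1" "0 < d" "0 < e" "0 < f"
  shows "((\<lambda>(x, y, z). q ^ (n + d * x + e * y + f * z)) has_sum
           (q ^ n / ((1 - q ^ d) * (1 - q ^ e) * (1 - q ^ f)))) UNIV"
  using has_sum_mult_Times[OF has_sum_geometric_power[OF assms(1,2)]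
      has_sum_two_parameters[OF assms(1,3,4), of n]]
  by (simp add: power_add mult_ac case_prod_unfold)

lemma has_sum_partitions_with_disj:
  fixes F :: "nat list \<Rightarrow> complex"
  assumes "(F has_sum s) (partitions_with P)" "(F has_sum t) (partitions_with Q)"
    and "\<And>a b c r. P a b c r \<Longrightarrow> Q a b c r \<Longrightarrow> False"
  shows "(F has_sum (s + t)) (partitions_with (\<lambda>a b c r. P a b c r \<or> Q a b c r))"
proof -
  have "partitions_with (\<lambda>a b c r. P a b c r \<or> Q a b c r) = partitions_with P \<union> partitions_with Q"
    by (auto simp: partitions_with_def)
  moreover have "partitions_with P \<inter> partitions_with Q = {}"
    using assms(3) by (auto simp: partitions_with_def)
  ultimately show ?thesis
    using has_sum_Un_disjoint[OF assms(1,2)] by simp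
qed

lemma has_sum_max_rook_number_3:
  fixes q :: complex
  assumes q: "norm q < 1"
  shows "((\<lambda>p. q ^ sum_list p) has_sum
           (q^6 * (1 + 2*q + q^2 + 2*q^3 - q^4 - q^6 - q^7 + q^8)
              / ((1 - q)^3 * (1 + q + q^2))))
         {p. integer_partition p \<and> max_rook_number p = 3}"
proof -
  let ?F = "\<lambda>p. q ^ sum_list p"
  note three = has_sum_three_parameters[OF q] and two = has_sum_two_parameters[OF q]
  have 1: "(?F has_sum (q^7 / ((1 - q) * (1 - q^2) * (1 - q))))
      (partitions_with (\<lambda>a b c r. 3 \<le> b \<and> c = 1))"
    using three[of 1 2 1 7]
    by (subst has_sum_reindex_bij_betw[OF bij_betw_third_one, symmetric])
      (simp add: case_prod_unfold sum_list_replicate algebra_simps)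
  have 2: "(?F has_sum (q^7 / ((1 - q) * (1 - q^2) * (1 - q))))
      (partitions_with (\<lambda>a b c r. 3 \<le> a \<and> b = 2 \<and> c = 2))"
    using three[of 1 2 1 7]
    by (subst has_sum_reindex_bij_betw[OF bij_betw_two_two, symmetric])
      (simp add: case_prod_unfold sum_list_replicate algebra_simps)
  have 3: "(?F has_sum (q^6 / ((1 - q) * (1 - q))))
      (partitions_with (\<lambda>a b c r. 3 \<le> a \<and> b = 2 \<and> c = 1))"
    using two[of 1 1 6]
    by (subst has_sum_reindex_bij_betw[OF bij_betw_two_one, symmetric])
      (simp add: case_prod_unfold sum_list_replicate algebra_simps)
  have 4: "(?F has_sum (q^8 / ((1 - q) * (1 - q^2))))
      (partitions_with (\<lambda>a b c r. r = [] \<and> 3 \<le> b \<and> c = 2))"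
    using two[of 1 2 8]
    by (subst has_sum_reindex_bij_betw[OF bij_betw_three_parts_last_two, symmetric])
      (simp add: case_prod_unfold algebra_simps)
  have 5: "(?F has_sum (q^9 / ((1 - q) * (1 - q^2) * (1 - q^3))))
      (partitions_with (\<lambda>a b c r. r = [] \<and> 3 \<le> c))"
    using three[of 1 2 3 9]
    by (subst has_sum_reindex_bij_betw[OF bij_betw_three_parts, symmetric])
      (simp add: case_prod_unfold algebra_simps)
  have 6: "(?F has_sum (q^8 / ((1 - q) * (1 - q^2)) - q^8))
      (partitions_with (\<lambda>a b c r. r \<noteq> [] \<and> a = 3 \<and> b = 3 \<and> c = 2))"
    using has_sum_Diff[OF two[of 1 2 8] has_sum_finite[of "{(0, 0)}"]]
    by (subst has_sum_reindex_bij_betw[OF bij_betw_parts_le_3_third_two, symmetric])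
      (simp add: case_prod_unfold sum_list_replicate algebra_simps)
  have 7: "(?F has_sum (q^9 / ((1 - q) * (1 - q^2) * (1 - q^3)) - q^9))
      (partitions_with (\<lambda>a b c r. r \<noteq> [] \<and> a = 3 \<and> b = 3 \<and> c = 3))"
    using has_sum_Diff[OF three[of 1 2 3 9] has_sum_finite[of "{(0, 0, 0)}"]]
    by (subst has_sum_reindex_bij_betw[OF bij_betw_parts_le_3, symmetric])
      (simp add: case_prod_unfold sum_list_replicate algebra_simps)
  note total = has_sum_partitions_with_disj[OF 1 has_sum_partitions_with_disj[OF 2
    has_sum_partitions_with_disj[OF 3 has_sum_partitions_with_disj[OF 4
    has_sum_partitions_with_disj[OF 5 has_sum_partitions_with_disj[OF 6 7]]]]]]
  have cases: "{p. integer_partition p \<and> max_rook_number p = 3} = partitions_with (\<lambda>a b c r.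
      3 \<le> b \<and> c = 1 \<or> 3 \<le> a \<and> b = 2 \<and> c = 2 \<or> 3 \<le> a \<and> b = 2 \<and> c = 1 \<or>
      r = [] \<and> 3 \<le> b \<and> c = 2 \<or> r = [] \<and> 3 \<le> c \<or>
      r \<noteq> [] \<and> a = 3 \<and> b = 3 \<and> c = 2 \<or> r \<noteq> [] \<and> a = 3 \<and> b = 3 \<and> c = 3)"
  proof -
    have "(3 \<le> a \<and> 2 \<le> b \<and> (r = [] \<or> c = 1 \<or> b = 2 \<or> a = 3)) \<longleftrightarrow>
      (3 \<le> b \<and> c = 1 \<or> 3 \<le> a \<and> b = 2 \<and> c = 2 \<or> 3 \<le> a \<and> b = 2 \<and> c = 1 \<or>
      r = [] \<and> 3 \<le> b \<and> c = 2 \<or> r = [] \<and> 3 \<le> c \<or>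
      r \<noteq> [] \<and> a = 3 \<and> b = 3 \<and> c = 2 \<or> r \<noteq> [] \<and> a = 3 \<and> b = 3 \<and> c = 3)"
      if "integer_partition (a # b # c # r)" for a b c r
    proof -
      have "b \<le> a" "c \<le> b" "1 \<le> c"
        using that by (auto simp: integer_partition_simps)
      then show ?thesis by (cases "r = []") (simp, arith)+
    qed
    then show ?thesis
      unfolding partitions_with_max_rook_number_3 by (rule partitions_with_cong)
  qed
  have "norm q \<noteq> norm (1::complex)" "norm q \<noteq> norm (-1::complex)"
    using q by auto
  then have nz: "1 - q \<noteq> 0" "1 + q \<noteq> 0"
    by (auto simp: add_eq_0_iff)
  have "norm (q ^ 3) < 1"
    using q by (simp add: norm_power power_less_one_iff)
  then have "1 - q ^ 3 \<noteq> 0" by auto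
  moreover have f3: "1 - q ^ 3 = (1 - q) * (1 + q + q^2)"
    by (simp add: power2_eq_square power3_eq_cube algebra_simps)
  ultimately have nz3: "1 + q + q^2 \<noteq> 0" by auto
  have f2: "1 - q ^ 2 = (1 - q) * (1 + q)"
    by (simp add: power2_eq_square algebra_simps)
  have eq: "q^7 / ((1 - q) * (1 - q^2) * (1 - q)) + (q^7 / ((1 - q) * (1 - q^2) * (1 - q)) +
      (q^6 / ((1 - q) * (1 - q)) + (q^8 / ((1 - q) * (1 - q^2)) +
      (q^9 / ((1 - q) * (1 - q^2) * (1 - q^3)) + (q^8 / ((1 - q) * (1 - q^2)) - q^8 +
      (q^9 / ((1 - q) * (1 - q^2) * (1 - q^3)) - q^9)))))) =
      q^6 * (1 + 2*q + q^2 + 2*q^3 - q^4 - q^6 - q^7 + q^8) / ((1 - q)^3 * (1 + q + q^2))"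
    unfolding f2 f3 using nz nz3
    by (simp add: divide_simps) algebra
  show ?thesis
    unfolding cases eq[symmetric] by (rule total) auto
qed

text \<open>Regrouping a sum over all partitions with max-rook number \<open>k\<close> according to size.\<close>
lemma has_sum_imp_sums_rook_partition_count:
  fixes q :: complex
  assumes "((\<lambda>p. q ^ sum_list p) has_sum s) {p. integer_partition p \<and> max_rook_number p = k}"
  shows "(\<lambda>n. of_nat (rook_partition_count k n) * q ^ n) sums s"
proof -
  define A where "A n = {p \<in> partitions_of n. max_rook_number p = k}" for n
  have "bij_betw snd (Sigma UNIV A) {p. integer_partition p \<and> max_rook_number p = k}"
    by (rule bij_betw_byWitness[where f' = "\<lambda>p. (sum_list p, p)"])
      (auto simp: A_def partitions_of_def integer_partition_def)
  then have "((\<lambda>t. q ^ sum_list (snd t)) has_sum s) (Sigma UNIV A)"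
    using assms by (subst has_sum_reindex_bij_betw)
  moreover have "((\<lambda>p. q ^ sum_list (snd (n, p))) has_sum
      (of_nat (rook_partition_count k n) * q ^ n)) (A n)" for n
  proof (rule has_sum_finiteI)
    show "finite (A n)"
      using finite_partitions_of by (simp add: A_def)
    have "(\<Sum>p\<in>A n. q ^ sum_list p) = (\<Sum>p\<in>A n. q ^ n)"
      by (rule sum.cong) (auto simp: A_def partitions_of_def)
    then show "of_nat (rook_partition_count k n) * q ^ n = (\<Sum>p\<in>A n. q ^ sum_list (snd (n, p)))"
      by (simp add: A_def rook_partition_count_def)
  qed
  ultimately have "((\<lambda>n. of_nat (rook_partition_count k n) * q ^ n) has_sum s) UNIV"
    by (rule has_sum_SigmaD)
  then show ?thesis by (rule has_sum_imp_sums)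
qed

theorem theorem3p2:
  fixes q :: complex
  assumes "norm q < 1"
  shows "(\<lambda>n. of_nat (rook_partition_count 3 (Suc n)) * q ^ Suc n) sums
           (q^6 * (1 + 2*q + q^2 + 2*q^3 - q^4 - q^6 - q^7 + q^8)
              / ((1 - q)^3 * (1 + q + q^2)))"
proof -
  have "{p \<in> partitions_of 0. max_rook_number p = 3} = {}"
  proof (intro equals0I)
    fix p assume "p \<in> {p \<in> partitions_of 0. max_rook_number p = 3}"
    then have "p \<in> {p. integer_partition p \<and> max_rook_number p = 3}" "sum_list p = 0"
      by (auto simp: partitions_of_def integer_partition_def)
    then show False
      unfolding partitions_with_max_rook_number_3 by (auto simp: partitions_with_def)
  qed
  then have "rook_partition_count 3 0 = 0"
    by (simp only: rook_partition_count_def card.empty)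
  then show ?thesis
    using has_sum_imp_sums_rook_partition_count[OF has_sum_max_rook_number_3[OF assms]]
    by (subst sums_Suc_iff) simp
qed

end
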